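(* Let $(\lambda_n)$ be a decreasing sequence of positive real numbers such that $\frac{\lambda_{n-2}}{\lambda_n}\to 1$ and $n^{3/2}\lambda_n\to L\in[0,+\infty]$ as $n\to\infty$. Let $P_n$ be the monic polynomial of degree $n$ orthogonal with respect to the weight $e^{-x^4}$ on $\mathbb{R}$, let $\Vert P_n\Vert^2=\int_{\mathbb{R}}P_n(x)^2e^{-x^4}\,dx$, and let $S_{n,\lambda_n}$ be the monic polynomial of degree $n$ minimizing $\langle Q,Q\rangle_{\lambda_n}=\int_{\mathbb{R}}Q(x)^2e^{-x^4}\,dx+\lambda_n\int_{\mathbb{R}}Q'(x)^2e^{-x^4}\,dx$ among all monic polynomials $Q$ of degree $n$. Then $$\lim_{n\to\infty}\frac{\langle S_{n,\lambda_n},S_{n,\lambda_n}\rangle_{\lambda_n}}{\Vert P_n\Vert^2}=\begin{cases}1 & \text{if } L=0,\\[4pt] \dfrac{2L}{\sqrt{3}}\,\varphi\left(\dfrac{20L+3\sqrt{3}}{12L}\right) & \text{if } 0<L<+\infty,\\[8pt] +\infty & \text{if } L=+\infty,\end{cases}$$ where $\varphi(x)=x+\sqrt{x^2-1}$.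
   Context: All polynomials have real coefficients. For $\lambda>0$, $\langle P,Q\rangle_\lambda=\int_{\mathbb{R}}P(x)Q(x)e^{-x^4}\,dx+\lambda\int_{\mathbb{R}}P'(x)Q'(x)e^{-x^4}\,dx$ is an inner product on the space of polynomials; the monic polynomial of degree $n$ minimizing $\langle Q,Q\rangle_\lambda$ over monic polynomials $Q$ of degree $n$ is unique and equals the monic orthogonal polynomial of degree $n$ for $\langle\cdot,\cdot\rangle_\lambda$. In $\varphi(x)=x+\sqrt{x^2-1}$, evaluated here at real $x>1$, the square root is the nonnegative one. "Decreasing" is understood in the non-strict sense (constant sequences are allowed). *)

theory Defs
  imports "HOL-Analysis.Analysis" "HOL-Computational_Algebra.Polynomial"
begin

definition freud_inner :: "real poly \<Rightarrow> real poly \<Rightarrow> real" where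
  "freud_inner P Q = (LBINT x. poly P x * poly Q x * exp (- (x ^ 4)))"

definition sobolev_inner :: "real \<Rightarrow> real poly \<Rightarrow> real poly \<Rightarrow> real" where
  "sobolev_inner l P Q = freud_inner P Q + l * freud_inner (pderiv P) (pderiv Q)"

definition monic_of_degree :: "nat \<Rightarrow> real poly \<Rightarrow> bool" where
  "monic_of_degree n P \<longleftrightarrow> degree P = n \<and> lead_coeff P = 1"

definition monic_orthogonal :: "nat \<Rightarrow> real poly \<Rightarrow> bool" where
  "monic_orthogonal n P \<longleftrightarrow>
     monic_of_degree n P \<and> (\<forall>Q. degree Q < n \<longrightarrow> freud_inner P Q = 0)"

definition sobolev_minimizer :: "nat \<Rightarrow> real \<Rightarrow> real poly \<Rightarrow> bool" where
  "sobolev_minimizer n l S \<longleftrightarrow>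
     is_arg_min (\<lambda>Q. sobolev_inner l Q Q) (monic_of_degree n) S"

(* Only evaluated at x > 1, where sqrt is the nonnegative root of a positive number. *)
definition phi :: "real \<Rightarrow> real" where
  "phi x = x + sqrt (x\<^sup>2 - 1)"

end

theory Submission
  imports Defs "HOL-Probability.Probability" "HOL-Real_Asymp.Real_Asymp"
begin

text \<open>
  Write \<open>h n\<close> for the squared norm of \<open>P n\<close> and \<open>c n = h n / h (n - 1)\<close>. Integration by parts gives
  \<open>P' n = n P (n - 1) + 4 h n / h (n - 3) P (n - 3)\<close> and the string equation
  \<open>4 c n (c (n + 1) + c n + c (n - 1)) = n\<close>. Comparing upper and lower limits in the latter, as Freud did,
  yields \<open>c n / sqrt n \<longlonglongrightarrow> 1 / sqrt 12\<close>.

  For a fixed parameter \<open>l\<close> the short formula for \<open>P' n\<close> makes the Sobolev orthogonal polynomials satisfy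
  \<open>S n = P n - b S (n - 2)\<close>, so their squared norms \<open>K l n\<close> obey a Riccati recurrence. With
  \<open>l = lam n\<close> the ratios \<open>K l n / h n\<close> satisfy asymptotically \<open>r n = a - b / r (n - 2)\<close>, and the claimed
  limit is the larger fixed point. The iteration contracts towards it because the minimality of the monic
  orthogonal polynomials gives \<open>r n \<ge> 1 + l n\<^sup>2 / c n\<close>, which stays away from the smaller fixed point.
\<close>

section \<open>Integration against the Freud weight\<close>

text \<open>As a functional of one polynomial, the integral reduces symmetry of
  \<open>freud_inner\<close> and moving a factor across it to commutativity of polynomial
  multiplication.\<close>

definition freud_integral :: "real poly \<Rightarrow> real" where
  "freud_integral p = (LBINT x. poly p x * exp (- (x ^ 4)))"

lemma freud_inner_eq: "freud_inner P Q = freud_integral (P * Q)"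
  by (simp add: freud_inner_def freud_integral_def)

text \<open>The weight is dominated by a multiple of the Gaussian density, all of whose absolute
  moments are finite.\<close>

lemma integrable_power_times_freud_weight:
  "integrable lborel (\<lambda>x::real. x ^ k * exp (- (x ^ 4)))"
proof (rule Bochner_Integration.integrable_bound)
  show "integrable lborel (\<lambda>x. exp 1 * sqrt (2 * pi) * (std_normal_density x * \<bar>x\<bar> ^ k))"
    by (intro integrable_mult_right integrable_std_normal_moment_abs)
  show "AE x in lborel. norm (x ^ k * exp (- (x ^ 4)))
      \<le> norm (exp 1 * sqrt (2 * pi) * (std_normal_density x * \<bar>x\<bar> ^ k))"
  proof (intro AE_I2)
    fix x :: real
    \<comment> \<open>Expanding (x^2 - 1/4)^2 >= 0 gives x^4 >= x^2/2 - 1/16.\<close>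
    have "- (x ^ 4) \<le> 1 + (- x\<^sup>2 / 2)"
      using zero_le_power2[of "x\<^sup>2 - 1/4"] by (simp add: power2_eq_square power4_eq_xxxx algebra_simps)
    then have "exp (- (x ^ 4)) \<le> exp 1 * exp (- x\<^sup>2 / 2)"
      by (simp flip: exp_add)
    then have "\<bar>x\<bar> ^ k * exp (- (x ^ 4)) \<le> \<bar>x\<bar> ^ k * (exp 1 * exp (- x\<^sup>2 / 2))"
      by (intro mult_left_mono) auto
    then show "norm (x ^ k * exp (- (x ^ 4)))
        \<le> norm (exp 1 * sqrt (2 * pi) * (std_normal_density x * \<bar>x\<bar> ^ k))"
      by (simp add: std_normal_density_def abs_mult power_abs field_simps)
  qed
qed simp

lemma integrable_poly_times_freud_weight:
  fixes p :: "real poly"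
  shows "integrable lborel (\<lambda>x. poly p x * exp (- (x ^ 4)))"
proof -
  have "integrable lborel (\<lambda>x. \<Sum>i\<le>degree p. coeff p i * (x ^ i * exp (- (x ^ 4))))"
    by (intro Bochner_Integration.integrable_sum integrable_mult_right
        integrable_power_times_freud_weight)
  then show ?thesis
    by (simp add: poly_altdef sum_distrib_right mult.assoc)
qed

lemma freud_integral_add: "freud_integral (p + q) = freud_integral p + freud_integral q"
  unfolding freud_integral_def
  by (simp add: distrib_right Bochner_Integration.integral_add integrable_poly_times_freud_weight)

lemma freud_integral_diff: "freud_integral (p - q) = freud_integral p - freud_integral q"
  unfolding freud_integral_def
  by (simp add: left_diff_distrib Bochner_Integration.integral_diff integrable_poly_times_freud_weight)

lemma freud_integral_smult: "freud_integral (smult c p) = c * freud_integral p"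
  unfolding freud_integral_def by (simp add: mult.assoc)

lemma freud_integral_0 [simp]: "freud_integral 0 = 0"
  by (simp add: freud_integral_def)

lemma freud_integral_reflect: "freud_integral (p \<circ>\<^sub>p [:0, -1:]) = freud_integral p"
  using lborel_integral_real_affine[of "-1" "\<lambda>x. poly p x * exp (- (x ^ 4))" 0]
  by (simp add: freud_integral_def poly_pcompose)

lemma freud_integral_odd:
  assumes "p \<circ>\<^sub>p [:0, -1:] = - p"
  shows "freud_integral p = 0"
  using freud_integral_reflect[of p] freud_integral_smult[of "-1" p] assms by simp

text \<open>The weight has logarithmic derivative -4 x^3, and \<open>monom 4 3\<close> is 4 x^3, so
  the difference of the two integrands is the derivative of p times the weight, which vanishes at
  both ends.\<close>

lemma freud_integral_by_parts: "freud_integral (pderiv p) = freud_integral (monom 4 3 * p)"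
proof -
  let ?F = "\<lambda>x. poly p x * exp (- (x ^ 4))"
  let ?f = "\<lambda>x. poly (pderiv p - monom 4 3 * p) x * exp (- (x ^ 4))"
  have lim: "(?F \<longlongrightarrow> 0) F" if "\<And>k. ((\<lambda>x::real. x ^ k * exp (- (x ^ 4))) \<longlongrightarrow> 0) F" for F
  proof -
    have "((\<lambda>x. \<Sum>i\<le>degree p. coeff p i * (x ^ i * exp (- (x ^ 4)))) \<longlongrightarrow> (\<Sum>i\<le>degree p. coeff p i * 0)) F"
      by (intro tendsto_sum tendsto_mult tendsto_const that)
    then show ?thesis
      by (simp add: poly_altdef sum_distrib_right mult.assoc)
  qed
  have top: "(?F \<longlongrightarrow> 0) at_top" and bot: "(?F \<longlongrightarrow> 0) at_bot"
    by (rule lim; real_asymp)+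
  have "(LBINT x=-\<infinity>..\<infinity>. ?f x) = 0 - 0"
  proof (rule interval_integral_FTC_integrable[where F = ?F])
    show "(?F has_vector_derivative ?f x) (at x)" for x
      unfolding has_real_derivative_iff_has_vector_derivative[symmetric]
      by (auto intro!: derivative_eq_intros simp: poly_monom algebra_simps)
    show "set_integrable lborel (einterval (-\<infinity>) \<infinity>) ?f"
      using integrable_poly_times_freud_weight[of "pderiv p - monom 4 3 * p"]
      by (simp add: set_integrable_def einterval_def)
    show "((?F \<circ> real_of_ereal) \<longlongrightarrow> 0) (at_right (-\<infinity>))"
      unfolding ereal_tendsto_simps by (rule bot)
    show "((?F \<circ> real_of_ereal) \<longlongrightarrow> 0) (at_left \<infinity>)"
      unfolding ereal_tendsto_simps by (rule top)
  qed (auto intro!: continuous_intros)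
  then have "freud_integral (pderiv p - monom 4 3 * p) = 0"
    by (simp add: freud_integral_def interval_lebesgue_integral_def einterval_def set_lebesgue_integral_def)
  then show ?thesis
    by (simp add: freud_integral_diff)
qed

section \<open>The inner product: bilinearity, parity and positivity\<close>

lemma freud_inner_commute: "freud_inner P Q = freud_inner Q P"
  by (simp add: freud_inner_eq mult.commute)

lemma freud_inner_add_left: "freud_inner (P + Q) R = freud_inner P R + freud_inner Q R"
  by (simp add: freud_inner_eq distrib_right freud_integral_add)

lemma freud_inner_add_right: "freud_inner P (Q + R) = freud_inner P Q + freud_inner P R"
  by (simp add: freud_inner_eq distrib_left freud_integral_add)

lemma freud_inner_diff_left: "freud_inner (P - Q) R = freud_inner P R - freud_inner Q R"
  by (simp add: freud_inner_eq left_diff_distrib freud_integral_diff)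

lemma freud_inner_diff_right: "freud_inner P (Q - R) = freud_inner P Q - freud_inner P R"
  by (simp add: freud_inner_eq right_diff_distrib freud_integral_diff)

lemma freud_inner_smult_left: "freud_inner (smult c P) Q = c * freud_inner P Q"
  by (simp add: freud_inner_eq freud_integral_smult)

lemma freud_inner_smult_right: "freud_inner P (smult c Q) = c * freud_inner P Q"
  by (simp add: freud_inner_eq freud_integral_smult)

lemma freud_inner_0_left [simp]: "freud_inner 0 P = 0"
  and freud_inner_0_right [simp]: "freud_inner P 0 = 0"
  by (simp_all add: freud_inner_eq)

lemmas freud_inner_linear =
  freud_inner_add_left freud_inner_add_right freud_inner_diff_left freud_inner_diff_right
  freud_inner_smult_left freud_inner_smult_right

lemma freud_inner_mult_shift: "freud_inner (M * P) Q = freud_inner P (M * Q)"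
  by (simp add: freud_inner_eq mult_ac)

lemma freud_inner_by_parts:
  "freud_inner (pderiv P) Q = freud_inner P (monom 4 3 * Q) - freud_inner P (pderiv Q)"
  using freud_integral_by_parts[of "P * Q"]
  by (simp add: freud_inner_eq pderiv_mult freud_integral_add mult_ac)

text \<open>Parity is expressed by eigenvalues under x -> -x; the product -1 says that the integrand
  is odd.\<close>

lemma freud_inner_odd:
  assumes "P \<circ>\<^sub>p [:0, -1:] = smult c P" "Q \<circ>\<^sub>p [:0, -1:] = smult d Q" "c * d = -1"
  shows "freud_inner P Q = 0"
  unfolding freud_inner_eq
  by (rule freud_integral_odd) (use assms in \<open>simp add: pcompose_mult mult.commute\<close>)

lemma freud_inner_self_nonneg: "0 \<le> freud_inner P P"
  unfolding freud_inner_def by (intro Bochner_Integration.integral_nonneg) simp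

text \<open>A zero integral would make P vanish almost everywhere, but its roots form a finite set,
  hence a null set.\<close>

lemma freud_inner_self_pos:
  assumes "P \<noteq> 0"
  shows "0 < freud_inner P P"
proof -
  have "freud_inner P P \<noteq> 0"
  proof
    assume "freud_inner P P = 0"
    moreover have "integrable lborel (\<lambda>x. poly P x * poly P x * exp (- (x ^ 4)))"
      using integrable_poly_times_freud_weight[of "P * P"] by simp
    ultimately have "AE x in lborel. poly P x * poly P x * exp (- (x ^ 4)) = 0"
      unfolding freud_inner_def by (subst (asm) integral_nonneg_eq_0_iff_AE) auto
    then have "AE x in lborel. x \<in> {x. poly P x = 0}"
      by eventually_elim simp
    moreover have "{x. poly P x = 0} \<in> null_sets lborel"
      using poly_roots_finite[OF assms] by (intro countable_imp_null_set_lborel countable_finite)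
    then have "AE x in lborel. x \<notin> {x. poly P x = 0}"
      by (rule AE_not_in)
    ultimately have "AE x in (lborel :: real measure). False"
      by eventually_elim simp
    then have "emeasure (lborel :: real measure) (space lborel) = 0"
      by (simp add: AE_iff_measurable[OF _ refl])
    then show False by simp
  qed
  with freud_inner_self_nonneg[of P] show ?thesis by simp
qed

text \<open>The zero polynomial needs its own alternative: its degree is 0 by convention, which is
  not below n when n = 0.\<close>

lemma degree_less_or_0:
  assumes "degree p \<le> n" "coeff p n = 0"
  shows "p = 0 \<or> degree p < n"
  using assms leading_coeff_0_iff le_neq_implies_less by blast

lemma monic_of_degree_nonzero: "monic_of_degree n P \<Longrightarrow> P \<noteq> 0"
  by (auto simp: monic_of_degree_def)

lemma monic_diff_degree:
  assumes "monic_of_degree n P" "monic_of_degree n Q"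
  shows "P - Q = 0 \<or> degree (P - Q) < n"
  by (rule degree_less_or_0) (use assms in \<open>auto simp: monic_of_degree_def intro: degree_diff_le\<close>)

section \<open>Orthogonal polynomials for the Freud weight\<close>

locale freud_polys =
  fixes P :: "nat \<Rightarrow> real poly"
  assumes orthogonal: "monic_orthogonal n (P n)"
begin

definition h :: "nat \<Rightarrow> real" where
  "h n = freud_inner (P n) (P n)"

text \<open>These are the three-term recurrence coefficients. Truncated subtraction makes
  \<open>c 0 = 1\<close>, so positivity holds without a case distinction.\<close>

definition c :: "nat \<Rightarrow> real" where
  "c n = h n / h (n - 1)"

lemma monic: "monic_of_degree n (P n)"
  using orthogonal by (simp add: monic_orthogonal_def)

lemma degree_P [simp]: "degree (P n) = n"
  and coeff_P [simp]: "coeff (P n) n = 1"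
  using monic[of n] by (auto simp: monic_of_degree_def)

lemma inner_low: "degree Q < n \<Longrightarrow> freud_inner (P n) Q = 0"
  using orthogonal by (simp add: monic_orthogonal_def)

lemma h_pos: "h n > 0"
  unfolding h_def using monic_of_degree_nonzero[OF monic] by (rule freud_inner_self_pos)

lemma h_nonzero [simp]: "h n \<noteq> 0"
  using h_pos[of n] by simp

lemma c_pos: "c n > 0"
  by (simp add: c_def h_pos)

lemma c_nonzero [simp]: "c n \<noteq> 0"
  using c_pos[of n] by simp

lemma h_Suc: "h (Suc n) = c (Suc n) * h n"
  by (simp add: c_def)

lemma inner_P: "freud_inner (P i) (P j) = (if i = j then h i else 0)"
  using inner_low[of "P i" j] inner_low[of "P j" i]
  by (cases i j rule: linorder_cases) (simp_all add: h_def freud_inner_commute)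

lemma inner_lead:
  assumes "degree Q \<le> n"
  shows "freud_inner (P n) Q = coeff Q n * h n"
proof -
  let ?R = "Q - smult (coeff Q n) (P n)"
  have "?R = 0 \<or> degree ?R < n"
    by (rule degree_less_or_0) (use assms in \<open>auto intro!: degree_diff_le\<close>)
  then have "freud_inner (P n) ?R = 0"
    using inner_low by auto
  then show ?thesis
    by (simp add: freud_inner_linear h_def)
qed

text \<open>Testing against \<open>P (degree R)\<close> isolates the leading coefficient. Expansions
  in the \<open>P k\<close> are verified by applying this to the difference of both sides.\<close>

lemma eq_0_if_orthogonal:
  assumes "degree R \<le> n" "\<And>k. k \<le> n \<Longrightarrow> freud_inner (P k) R = 0"
  shows "R = 0"
  using assms(2)[OF assms(1)] inner_lead[of R "degree R"] by simp

text \<open>The weight is even, so the reflected polynomial with corrected sign is again monic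
  orthogonal; its difference from \<open>P n\<close> has lower degree and is therefore orthogonal to
  itself.\<close>

lemma reflect_P: "P n \<circ>\<^sub>p [:0, -1:] = smult ((-1) ^ n) (P n)"
proof -
  let ?r = "[:0, -1:] :: real poly"
  let ?Q = "smult ((-1) ^ n) (P n \<circ>\<^sub>p ?r)"
  have deg: "degree (R \<circ>\<^sub>p ?r) = degree R" for R :: "real poly"
    by (simp add: degree_pcompose)
  have "monic_of_degree n ?Q"
    using lead_coeff_comp[of ?r "P n"]
    by (simp add: monic_of_degree_def deg flip: power_mult_distrib)
  then have low: "?Q - P n = 0 \<or> degree (?Q - P n) < n"
    using monic by (rule monic_diff_degree)
  have "freud_inner ?Q R = 0" if "degree R < n" for R
  proof -
    have "(P n \<circ>\<^sub>p ?r) * R = (P n * (R \<circ>\<^sub>p ?r)) \<circ>\<^sub>p ?r"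
      by (simp add: pcompose_mult pcompose_assoc[symmetric] pcompose_pCons pcompose_idR)
    then have "freud_inner (P n \<circ>\<^sub>p ?r) R = freud_inner (P n) (R \<circ>\<^sub>p ?r)"
      by (simp add: freud_inner_eq freud_integral_reflect)
    then show ?thesis
      using inner_low[of "R \<circ>\<^sub>p ?r" n] that by (simp add: freud_inner_linear deg)
  qed
  with low have "freud_inner (?Q - P n) (?Q - P n) = 0"
    using inner_low by (metis freud_inner_diff_left freud_inner_0_left diff_self)
  then have "?Q - P n = 0"
    using freud_inner_self_pos[of "?Q - P n"] by fastforce
  then have "smult ((-1) ^ n) ?Q = smult ((-1) ^ n) (P n)"
    by simp
  then show ?thesis
    by (simp flip: power_mult_distrib)
qed

section \<open>Recurrences for the orthogonal polynomials and their norms\<close>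

lemma inner_monom_odd:
  assumes "odd (n + m + k)"
  shows "freud_inner (P n) (monom a k * P m) = 0"
proof (rule freud_inner_odd[OF reflect_P])
  have "monom a k \<circ>\<^sub>p [:0, -1:] = smult ((-1) ^ k) (monom a k)"
    by (intro poly_ext) (simp add: poly_pcompose poly_monom flip: power_mult_distrib)
  then show "(monom a k * P m) \<circ>\<^sub>p [:0, -1:] = smult ((-1) ^ (k + m)) (monom a k * P m)"
    by (simp add: pcompose_mult reflect_P power_add mult.commute)
  show "(- 1) ^ n * (- 1) ^ (k + m) = (- 1 :: real)"
    using assms by (simp flip: power_add add: ac_simps)
qed

text \<open>Multiplication by x is self-adjoint, so components below \<open>P n\<close> vanish; the
  one along \<open>P (Suc n)\<close> vanishes by parity.\<close>

lemma three_term: "[:0, 1:] * P (Suc n) = P (Suc (Suc n)) + smult (c (Suc n)) (P n)"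
proof -
  let ?R = "[:0, 1:] * P (Suc n) - P (Suc (Suc n)) - smult (c (Suc n)) (P n)"
  have X: "coeff ([:0, 1:] * Q) (Suc k) = coeff Q k" for Q :: "real poly" and k
    by simp
  have dX: "degree ([:0, 1:] * Q) \<le> Suc (degree Q)" for Q :: "real poly"
    by (simp add: degree_pCons_le)
  have "?R = 0 \<or> degree ?R < Suc (Suc n)"
    by (rule degree_less_or_0)
      (use dX[of "P (Suc n)"] in \<open>auto intro!: degree_diff_le simp: X coeff_eq_0\<close>)
  then have "degree ?R \<le> Suc n" by auto
  then have "?R = 0"
  proof (rule eq_0_if_orthogonal)
    fix k assume "k \<le> Suc n"
    then consider "k < n" | "k = n" | "k = Suc n" by linarith
    then show "freud_inner (P k) ?R = 0"
    proof cases
      case 1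
      have "freud_inner (P (Suc n)) ([:0, 1:] * P k) = 0"
        by (rule inner_low) (use dX[of "P k"] 1 in auto)
      then have "freud_inner (P k) ([:0, 1:] * P (Suc n)) = 0"
        by (metis freud_inner_commute freud_inner_mult_shift)
      with 1 show ?thesis
        by (simp add: freud_inner_linear inner_P)
    next
      case 2
      have "freud_inner (P (Suc n)) ([:0, 1:] * P n) = h (Suc n)"
        by (subst inner_lead) (use dX[of "P n"] in \<open>auto simp: X\<close>)
      then have "freud_inner (P n) ([:0, 1:] * P (Suc n)) = h (Suc n)"
        by (metis freud_inner_commute freud_inner_mult_shift)
      with 2 show ?thesis
        by (simp add: freud_inner_linear inner_P flip: h_Suc)
    next
      case 3
      then show ?thesis
        using inner_monom_odd[of "Suc n" "Suc n" 1 1]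
        by (simp add: freud_inner_linear inner_P monom_altdef)
    qed
  qed
  then show ?thesis by (simp add: algebra_simps)
qed

text \<open>The other boundary-free term, with the derivative on \<open>P k\<close>, dies by
  orthogonality. What remains vanishes as soon as k + 3 < n, which makes the expansion of the
  derivative short.\<close>

lemma pderiv_inner:
  assumes "k < n"
  shows "freud_inner (P k) (pderiv (P n)) = freud_inner (P n) (monom 4 3 * P k)"
  using assms freud_inner_by_parts[of "P n" "P k"] inner_low[of "pderiv (P k)" n]
  by (simp add: freud_inner_commute[of "P k" "pderiv (P n)"] degree_pderiv)

lemma pderiv_lead: "freud_inner (P n) (pderiv (P (Suc n))) = real (Suc n) * h n"
  by (subst inner_lead) (auto simp: degree_pderiv coeff_pderiv)

text \<open>Below index n the coefficients vanish by degree, at n + 1 by parity; those at n and n +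
  2 come from leading coefficients.\<close>

lemma pderiv_P:
  "pderiv (P (n + 3)) = smult (real (n + 3)) (P (n + 2)) + smult (4 * h (n + 3) / h n) (P n)"
proof -
  let ?R = "pderiv (P (n + 3)) - smult (real (n + 3)) (P (n + 2)) - smult (4 * h (n + 3) / h n) (P n)"
  have "degree ?R \<le> n + 2"
    by (auto intro!: degree_diff_le simp: degree_pderiv)
  then have "?R = 0"
  proof (rule eq_0_if_orthogonal)
    fix k assume "k \<le> n + 2"
    then consider "k < n" | "k = n" | "k = Suc n" | "k = n + 2" by linarith
    then show "freud_inner (P k) ?R = 0"
    proof cases
      case 1
      have "freud_inner (P (n + 3)) (monom 4 3 * P k) = 0"
        by (rule inner_low) (use 1 in \<open>auto simp: degree_monom_eq intro: le_less_trans[OF degree_mult_le]\<close>)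
      with 1 show ?thesis
        using pderiv_inner[of k "n + 3"]
        by (simp add: freud_inner_linear inner_P)
    next
      case 2
      have "freud_inner (P (n + 3)) (monom 4 3 * P n) = 4 * h (n + 3)"
        by (subst inner_lead) (auto simp: degree_monom_eq coeff_monom_mult intro: order.trans[OF degree_mult_le])
      with 2 show ?thesis
        using pderiv_inner[of n "n + 3"]
        by (simp add: freud_inner_linear inner_P)
    next
      case 3
      then show ?thesis
        using pderiv_inner[of "Suc n" "n + 3"]
          inner_monom_odd[of "n + 3" "Suc n" 3 4]
        by (simp add: freud_inner_linear inner_P)
    next
      case 4
      then show ?thesis
        using pderiv_lead[of "n + 2"]
        by (simp add: freud_inner_linear inner_P eval_nat_numeral)
    qed
  qed
  then show ?thesis by (simp add: algebra_simps)
qed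

text \<open>The inner product of the derivative of \<open>P (n + 3)\<close> with
  \<open>P (n + 2)\<close> is computed twice: from the leading coefficient, and by parts followed by
  the three-term recurrence.\<close>

lemma string_equation:
  "4 * c (n + 3) * (c (n + 4) + c (n + 3) + c (n + 2)) = real (n + 3)"
proof -
  define X :: "real poly" where "X = [:0, 1:]"
  have m: "monom 4 3 = smult 4 (X * (X * X))"
    by (simp add: monom_altdef power3_eq_cube X_def)
  \<comment> \<open>Separating n from the offsets lets numerals unfold to \<open>Suc\<close> terms
    that match the recurrence.\<close>
  define p where "p k = P (n + k)" for k
  define a where "a k = c (n + k)" for k
  have tt: "X * p (Suc k) = p (Suc (Suc k)) + smult (a (Suc k)) (p k)" for k
    using three_term[of "n + k"] by (simp add: p_def a_def X_def)
  have ip: "freud_inner (p i) (p j) = (if i = j then h (n + i) else 0)" for i j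
    by (simp add: p_def inner_P)
  have hh: "h (n + Suc k) = a (Suc k) * h (n + k)" for k
    using h_Suc[of "n + k"] by (simp add: a_def)
  have "real (n + 3) * h (n + 2) = freud_inner (P (n + 3)) (monom 4 3 * P (n + 2))"
    using pderiv_lead[of "n + 2"] pderiv_inner[of "n + 2" "n + 3"] by (simp add: eval_nat_numeral)
  also have "\<dots> = 4 * freud_inner (X * p 3) (X * (X * p 2))"
    by (simp add: m freud_inner_linear freud_inner_mult_shift p_def mult.assoc)
  also have "\<dots> = 4 * a 3 * (a 4 + a 3 + a 2) * h (n + 2)"
    using tt[of 2] tt[of 1] tt[of 0] hh[of 2] hh[of 3]
    by (simp add: eval_nat_numeral freud_inner_linear ip algebra_simps)
  finally show ?thesis
    by (simp add: a_def)
qed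

section \<open>Norms of derivatives and extremal properties\<close>

lemma inner_pderiv_self:
  "freud_inner (pderiv (P (n + 3))) (pderiv (P (n + 3)))
    = (real (n + 3))\<^sup>2 * h (n + 2) + 16 * (h (n + 3))\<^sup>2 / h n"
  by (simp add: pderiv_P freud_inner_linear inner_P power2_eq_square)

lemma monic_norm_ge:
  assumes "monic_of_degree n Q"
  shows "h n \<le> freud_inner Q Q"
proof -
  define R where "R = Q - P n"
  have "R = 0 \<or> degree R < n"
    unfolding R_def using assms monic by (rule monic_diff_degree)
  then have "freud_inner (P n) R = 0"
    using inner_low by auto
  moreover have "Q = P n + R" by (simp add: R_def)
  ultimately show ?thesis
    using freud_inner_self_nonneg[of R]
    by (simp add: freud_inner_linear freud_inner_commute[of R "P n"] h_def)
qed

text \<open>Dividing the derivative by its leading coefficient n + 1 gives a monic competitor of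
  degree n.\<close>

lemma monic_pderiv_norm_ge:
  assumes "monic_of_degree (Suc n) Q"
  shows "(real (Suc n))\<^sup>2 * h n \<le> freud_inner (pderiv Q) (pderiv Q)"
proof -
  define R where "R = smult (1 / real (Suc n)) (pderiv Q)"
  have "monic_of_degree n R"
    using assms by (auto simp: monic_of_degree_def R_def degree_pderiv coeff_pderiv)
  then have "h n \<le> freud_inner R R" by (rule monic_norm_ge)
  moreover have "pderiv Q = smult (real (Suc n)) R" by (simp add: R_def del: of_nat_Suc)
  ultimately show ?thesis
    by (simp add: freud_inner_linear power2_eq_square mult.assoc del: of_nat_Suc)
qed

end

section \<open>Sobolev orthogonal polynomials\<close>

lemma sobolev_inner_commute: "sobolev_inner l P Q = sobolev_inner l Q P"
  by (simp add: sobolev_inner_def freud_inner_commute)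

lemma sobolev_inner_linear:
  "sobolev_inner l (P + Q) R = sobolev_inner l P R + sobolev_inner l Q R"
  "sobolev_inner l P (Q + R) = sobolev_inner l P Q + sobolev_inner l P R"
  "sobolev_inner l (P - Q) R = sobolev_inner l P R - sobolev_inner l Q R"
  "sobolev_inner l P (Q - R) = sobolev_inner l P Q - sobolev_inner l P R"
  "sobolev_inner l (smult a P) Q = a * sobolev_inner l P Q"
  "sobolev_inner l P (smult a Q) = a * sobolev_inner l P Q"
  by (simp_all add: sobolev_inner_def pderiv_add pderiv_diff pderiv_smult freud_inner_linear algebra_simps)

lemma sobolev_inner_0_right [simp]: "sobolev_inner l P 0 = 0"
  by (simp add: sobolev_inner_def)

lemma sobolev_inner_self_nonneg: "0 \<le> l \<Longrightarrow> 0 \<le> sobolev_inner l P P"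
  by (simp add: sobolev_inner_def freud_inner_self_nonneg)

lemma sobolev_inner_self_mono: "l \<le> m \<Longrightarrow> sobolev_inner l P P \<le> sobolev_inner m P P"
  by (simp add: sobolev_inner_def freud_inner_self_nonneg mult_right_mono)

text \<open>The factor m / l turns the derivative term for l into that for m exactly and can only
  enlarge the other term.\<close>

lemma sobolev_inner_self_scale:
  assumes "0 < l" "l \<le> m"
  shows "sobolev_inner m P P \<le> m / l * sobolev_inner l P P"
proof -
  have "1 * freud_inner P P \<le> m / l * freud_inner P P"
    using assms by (intro mult_right_mono freud_inner_self_nonneg) auto
  then show ?thesis
    using assms by (simp add: sobolev_inner_def distrib_left)
qed

lemma pderiv_reflect:
  fixes P :: "'a::idom poly"
  assumes "P \<circ>\<^sub>p [:0, -1:] = smult a P"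
  shows "pderiv P \<circ>\<^sub>p [:0, -1:] = smult (- a) (pderiv P)"
proof -
  have "smult (-1) (pderiv P \<circ>\<^sub>p [:0, -1:]) = smult a (pderiv P)"
    using arg_cong[OF assms, of pderiv] by (simp add: pderiv_pcompose pderiv_pCons pderiv_smult)
  then have "smult (-1) (smult (-1) (pderiv P \<circ>\<^sub>p [:0, -1:])) = smult (-1) (smult a (pderiv P))"
    by (rule arg_cong)
  then show ?thesis by simp
qed

lemma sobolev_inner_odd:
  assumes "P \<circ>\<^sub>p [:0, -1:] = smult a P" "Q \<circ>\<^sub>p [:0, -1:] = smult b Q" "a * b = -1"
  shows "sobolev_inner l P Q = 0"
  using freud_inner_odd[OF assms] freud_inner_odd[OF assms(1,2)[THEN pderiv_reflect]] assms(3)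
  by (simp add: sobolev_inner_def)

section \<open>Recursive construction of the Sobolev orthogonal polynomials\<close>

context freud_polys
begin

text \<open>One Gram-Schmidt step: the numerator is the Sobolev inner product of
  \<open>P (Suc (Suc n))\<close> with the monic \<open>sob l n\<close>.\<close>

fun sob :: "real \<Rightarrow> nat \<Rightarrow> real poly" where
  "sob l 0 = P 0"
| "sob l (Suc 0) = P (Suc 0)"
| "sob l (Suc (Suc n)) = P (Suc (Suc n)) -
     smult (4 * l * real n * h (Suc (Suc n)) / sobolev_inner l (sob l n) (sob l n)) (sob l n)"

definition K :: "real \<Rightarrow> nat \<Rightarrow> real" where
  "K l n = sobolev_inner l (sob l n) (sob l n)"

lemma monic_sob: "monic_of_degree n (sob l n)"
proof (induction l n rule: sob.induct)
  case (3 l n)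
  then have "degree (sob l n) = n" by (simp add: monic_of_degree_def)
  then have "coeff (sob l (Suc (Suc n))) (Suc (Suc n)) = 1" "degree (sob l (Suc (Suc n))) \<le> Suc (Suc n)"
    by (auto simp: coeff_eq_0 intro!: degree_diff_le)
  then show ?case
    by (metis antisym le_degree monic_of_degree_def zero_neq_one)
qed (auto simp: monic)

lemma degree_sob [simp]: "degree (sob l n) = n"
  and coeff_sob [simp]: "coeff (sob l n) n = 1"
  using monic_sob[of n l] by (auto simp: monic_of_degree_def)

lemma reflect_sob: "sob l n \<circ>\<^sub>p [:0, -1:] = smult ((-1) ^ n) (sob l n)"
  by (induction l n rule: sob.induct)
    (auto simp: reflect_P pcompose_diff pcompose_smult smult_diff_right mult.commute)

lemma K_ge_h: "0 \<le> l \<Longrightarrow> h n \<le> K l n"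
  using monic_norm_ge[OF monic_sob[of n l]] freud_inner_self_nonneg[of "pderiv (sob l n)"]
  by (simp add: K_def sobolev_inner_def add_increasing2)

lemma K_pos: "0 \<le> l \<Longrightarrow> 0 < K l n"
  using K_ge_h[of l n] h_pos[of n] by linarith

lemma K_ge: "0 \<le> l \<Longrightarrow> h (Suc n) + l * (real (Suc n))\<^sup>2 * h n \<le> K l (Suc n)"
  unfolding K_def sobolev_inner_def mult.assoc
  by (intro add_mono mult_left_mono monic_norm_ge monic_pderiv_norm_ge monic_sob)

text \<open>Integration by parts leaves only \<open>P (Suc (Suc n))\<close> against 4 x^3 Q', of
  degree at most n + 2. On degrees up to n the functional thus sees only the top coefficient, so one
  correction term in \<open>sob\<close> suffices.\<close>

lemma sobolev_inner_P:
  assumes "degree Q \<le> n"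
  shows "sobolev_inner l (P (Suc (Suc n))) Q = 4 * l * real n * coeff Q n * h (Suc (Suc n))"
proof -
  \<comment> \<open>For n = 0 the degree estimate for a product would only give 3; that case is
    settled by Q' = 0.\<close>
  have d: "degree (monom 4 3 * pderiv Q) \<le> Suc (Suc n)" if "n \<noteq> 0"
    using assms that by (intro order.trans[OF degree_mult_le]) (auto simp: degree_monom_eq degree_pderiv)
  have "freud_inner (P (Suc (Suc n))) (monom 4 3 * pderiv Q) = 4 * real n * coeff Q n * h (Suc (Suc n))"
  proof (cases n)
    case 0
    with assms have "pderiv Q = 0" by (simp add: pderiv_eq_0_iff)
    with 0 show ?thesis by simp
  next
    case (Suc k)
    then show ?thesis
      using inner_lead[OF d] by (simp add: coeff_monom_mult coeff_pderiv eval_nat_numeral)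
  qed
  then show ?thesis
    using freud_inner_by_parts[of "P (Suc (Suc n))" "pderiv Q"] inner_low[of Q "Suc (Suc n)"]
      inner_low[of "pderiv (pderiv Q)" "Suc (Suc n)"] assms
    by (simp add: sobolev_inner_def degree_pderiv)
qed

lemma sob_orthogonal:
  assumes "0 \<le> l" "degree Q < n"
  shows "sobolev_inner l (sob l n) Q = 0"
  using assms(2)
proof (induction n arbitrary: Q rule: less_induct)
  case (less n)
  consider "n = 0" | "n = Suc 0" | m where "n = Suc (Suc m)"
    using less_Suc0 not0_implies_Suc by metis
  then show ?case
  proof cases
    case 1
    with less show ?thesis by simp
  next
    case 2
    with less inner_low[of Q 1] show ?thesis
      by (simp add: sobolev_inner_def) (metis degree_eq_zeroE pderiv_singleton freud_inner_0_right)
  next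
    case (3 m)
    \<comment> \<open>Pairing with \<open>P n\<close> and pairing with \<open>sob l m\<close> both
      give multiples of the coefficient of R at m, and the recursion makes them cancel.\<close>
    have low: "sobolev_inner l (sob l n) R = 0" if "degree R \<le> m" for R
    proof -
      let ?T = "R - smult (coeff R m) (sob l m)"
      have "?T = 0 \<or> degree ?T < m"
        by (rule degree_less_or_0) (use that in \<open>auto intro!: degree_diff_le\<close>)
      then have "sobolev_inner l (sob l m) ?T = 0"
        using less.IH[of m ?T] 3 by auto
      then have "sobolev_inner l (sob l m) R = coeff R m * K l m"
        by (simp add: sobolev_inner_linear K_def)
      then show ?thesis
        using that K_pos[OF assms(1), of m] 3
        by (simp add: sobolev_inner_linear sobolev_inner_P flip: K_def)
    qed
    \<comment> \<open>The remaining component, of degree m + 1, has parity opposite to that of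
      \<open>sob l n\<close>.\<close>
    let ?R = "Q - smult (coeff Q (Suc m)) (sob l (Suc m))"
    have "?R = 0 \<or> degree ?R < Suc m"
      by (rule degree_less_or_0) (use less.prems 3 in \<open>auto intro!: degree_diff_le\<close>)
    then have "sobolev_inner l (sob l n) ?R = 0"
      using low by auto
    moreover have "sobolev_inner l (sob l n) (sob l (Suc m)) = 0"
      by (rule sobolev_inner_odd[OF reflect_sob reflect_sob]) (simp add: 3 flip: power_mult_distrib)
    ultimately show ?thesis
      by (simp add: sobolev_inner_linear)
  qed
qed

lemma K_minimal:
  assumes "0 \<le> l" "monic_of_degree n Q"
  shows "K l n \<le> sobolev_inner l Q Q"
proof -
  define R where "R = Q - sob l n"
  have "R = 0 \<or> degree R < n"
    unfolding R_def using assms(2) monic_sob by (rule monic_diff_degree)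
  then have "sobolev_inner l (sob l n) R = 0"
    using sob_orthogonal[OF assms(1)] by auto
  moreover have "Q = sob l n + R" by (simp add: R_def)
  ultimately show ?thesis
    using sobolev_inner_self_nonneg[OF assms(1), of R]
    by (simp add: sobolev_inner_linear sobolev_inner_commute[of l R "sob l n"] K_def)
qed

text \<open>Comparing values in both directions suffices; uniqueness of the minimizer need not be
  established.\<close>

lemma sobolev_minimizer_norm:
  assumes "0 \<le> l" "sobolev_minimizer n l Q"
  shows "sobolev_inner l Q Q = K l n"
  using assms K_minimal[OF assms(1), of n Q] monic_sob[of n l]
  by (intro antisym) (auto simp: sobolev_minimizer_def is_arg_min_linorder K_def)

text \<open>The minimizer for m serves as a competitor for l; in \<open>K_scale\<close> the roles
  are exchanged.\<close>

lemma K_mono: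
  assumes "0 \<le> l" "l \<le> m"
  shows "K l n \<le> K m n"
  using K_minimal[OF assms(1) monic_sob, of n m] sobolev_inner_self_mono[OF assms(2), of "sob m n"]
  by (simp add: K_def)

lemma K_scale:
  assumes "0 < l" "l \<le> m"
  shows "K m n \<le> m / l * K l n"
  using K_minimal[OF _ monic_sob, of m n l] sobolev_inner_self_scale[OF assms, of "sob l n"] assms
  by (simp add: K_def)

text \<open>Pythagoras for the orthogonal decomposition of \<open>P (n + 3)\<close> into
  \<open>sob l (n + 3)\<close> and a multiple of \<open>sob l (n + 1)\<close>.\<close>

lemma K_recurrence:
  assumes "0 \<le> l"
  shows "K l (n + 3) = h (n + 3) + l * ((real (n + 3))\<^sup>2 * h (n + 2) + 16 * (h (n + 3))\<^sup>2 / h n)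
    - 16 * l\<^sup>2 * (real (n + 1))\<^sup>2 * (h (n + 3))\<^sup>2 / K l (n + 1)"
proof -
  define b where "b = 4 * l * real (n + 1) * h (n + 3) / K l (n + 1)"
  have "P (n + 3) = sob l (n + 3) + smult b (sob l (n + 1))"
    by (simp add: b_def K_def eval_nat_numeral)
  moreover have "sobolev_inner l (sob l (n + 3)) (sob l (n + 1)) = 0"
    by (rule sob_orthogonal[OF assms]) simp
  ultimately have "sobolev_inner l (P (n + 3)) (P (n + 3)) = K l (n + 3) + b\<^sup>2 * K l (n + 1)"
    using sobolev_inner_commute[of l "sob l (n + 1)" "sob l (n + 3)"]
    by (simp add: sobolev_inner_linear K_def power2_eq_square del: sob.simps)
  moreover have "b\<^sup>2 * K l (n + 1) = 16 * l\<^sup>2 * (real (n + 1))\<^sup>2 * (h (n + 3))\<^sup>2 / K l (n + 1)"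
    using K_pos[OF assms, of "n + 1"] by (simp add: b_def power2_eq_square field_simps)
  ultimately show ?thesis
    by (simp add: sobolev_inner_def inner_pderiv_self flip: h_def)
qed

end

section \<open>Limits of recurrences\<close>

text \<open>With i and s the lower and upper limits, subsequences attaining them give q <= i (2 s +
  i) and s (2 i + s) <= q. Hence s^2 <= i^2, so i = s and q = 3 i^2. The weights u and v absorb
  changes of normalization between neighbours.\<close>

lemma freud_limit:
  fixes y u v :: "nat \<Rightarrow> real"
  assumes nonneg: "\<And>n. 0 \<le> y n" "\<And>n. 0 \<le> u n" "\<And>n. 0 \<le> v n"
    and bound: "\<And>n. y n \<le> B"
    and u: "u \<longlonglongrightarrow> 1" and v: "v \<longlonglongrightarrow> 1"
    and lim: "(\<lambda>n. y (n + 1) * (u n * y (n + 2) + y (n + 1) + v n * y n)) \<longlonglongrightarrow> q"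
  shows "y \<longlonglongrightarrow> sqrt (q / 3)"
proof -
  define Y where "Y = (\<lambda>n. ereal (y n))"
  have Y0: "0 \<le> liminf Y" "limsup Y \<le> ereal B"
    using nonneg(1) bound by (auto simp: Y_def intro!: Liminf_bounded Limsup_bounded)
  have Yle: "liminf Y \<le> limsup Y" by (simp add: Liminf_le_Limsup)
  obtain i where i: "liminf Y = ereal i"
    using Y0 Yle by (cases "liminf Y") auto
  obtain s where s: "limsup Y = ereal s"
    using Y0 Yle by (cases "limsup Y") auto
  have is_nonneg: "0 \<le> i" "0 \<le> s" using Y0 Yle i s by auto
  have upper: "\<forall>\<^sub>F n in sequentially. y n \<le> s + e" if "e > 0" for e
  proof -
    have "limsup Y < ereal (s + e)" using that by (simp add: s)
    then show ?thesis
      by (rule Limsup_lessD[THEN eventually_mono]) (simp add: Y_def)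
  qed
  have lower: "\<forall>\<^sub>F n in sequentially. i - e \<le> y n" if "e > 0" for e
  proof -
    have "ereal (i - e) < liminf Y" using that by (simp add: i)
    then show ?thesis
      by (rule less_LiminfD[THEN eventually_mono]) (simp add: Y_def)
  qed
  have shift: "\<forall>\<^sub>F k in sequentially. Q (t k) \<and> Q (t k + 2)"
    if "eventually Q sequentially" "filterlim t sequentially sequentially" for Q t
  proof -
    have "\<forall>\<^sub>F n in sequentially. Q n \<and> Q (n + 2)"
      using that(1) eventually_sequentially_seg[of Q 2] by (simp add: eventually_conj)
    then show ?thesis
      using that(2) by (rule eventually_compose_filterlim)
  qed
  \<comment> \<open>The extremal term must be the middle one, so indices move back by one; skipping
    the first index of r keeps the subtraction from truncating.\<close>
  have subseq: "\<exists>t. filterlim t sequentially sequentially \<and> (\<lambda>k. y (t k + 1)) \<longlonglongrightarrow> w"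
    if "strict_mono r" "(Y \<circ> r) \<longlonglongrightarrow> ereal w" for r w
  proof (intro exI conjI)
    have r: "r (k + 1) - 1 + 1 = r (k + 1)" for k
      using strict_mono_imp_increasing[OF that(1), of "k + 1"] by linarith
    have "k \<le> r (k + 1) - 1" for k
      using strict_mono_imp_increasing[OF that(1), of "k + 1"] by linarith
    then show "filterlim (\<lambda>k. r (k + 1) - 1) sequentially sequentially"
      by (intro filterlim_at_top_mono[OF filterlim_ident]) auto
    have "(\<lambda>k. y (r k)) \<longlonglongrightarrow> w"
      using that(2) by (simp add: Y_def comp_def)
    then show "(\<lambda>k. y (r (k + 1) - 1 + 1)) \<longlonglongrightarrow> w"
      unfolding r by (rule LIMSEQ_ignore_initial_segment)
  qed
  have "q \<le> i * (2 * (s + e) + i)" if "e > 0" for e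
  proof -
    obtain t where t: "filterlim t sequentially sequentially" "(\<lambda>k. y (t k + 1)) \<longlonglongrightarrow> i"
      using liminf_subseq_lim[of Y] subseq i by metis
    note [tendsto_intros] = t(2) filterlim_compose[OF u t(1)] filterlim_compose[OF v t(1)]
    have "(\<lambda>k. y (t k + 1) * (u (t k) * (s + e) + y (t k + 1) + v (t k) * (s + e)))
        \<longlonglongrightarrow> i * (1 * (s + e) + i + 1 * (s + e))"
      by (intro tendsto_intros)
    moreover have "\<forall>\<^sub>F k in sequentially.
        y (t k + 1) * (u (t k) * y (t k + 2) + y (t k + 1) + v (t k) * y (t k))
        \<le> y (t k + 1) * (u (t k) * (s + e) + y (t k + 1) + v (t k) * (s + e))"
      using shift[OF upper[OF that] t(1)]
      by eventually_elim (auto intro!: mult_left_mono add_mono nonneg)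
    ultimately have "q \<le> i * (1 * (s + e) + i + 1 * (s + e))"
      by (intro tendsto_le[OF _ _ filterlim_compose[OF lim t(1)]]) auto
    then show ?thesis by (simp add: algebra_simps)
  qed
  \<comment> \<open>Let e tend to 0 from the right.\<close>
  then have q1: "q \<le> i * (2 * s + i)"
    by (intro tendsto_lowerbound[where F = "at_right 0" and f = "\<lambda>e. i * (2 * (s + e) + i)"])
      (auto intro!: tendsto_eq_intros eventually_at_right_less[THEN eventually_mono])
  have "s * (2 * (i - e) + s) \<le> q" if "e > 0" for e
  proof -
    obtain t where t: "filterlim t sequentially sequentially" "(\<lambda>k. y (t k + 1)) \<longlonglongrightarrow> s"
      using limsup_subseq_lim[of Y] subseq s by metis
    note [tendsto_intros] = t(2) filterlim_compose[OF u t(1)] filterlim_compose[OF v t(1)]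
    have "(\<lambda>k. y (t k + 1) * (u (t k) * (i - e) + y (t k + 1) + v (t k) * (i - e)))
        \<longlonglongrightarrow> s * (1 * (i - e) + s + 1 * (i - e))"
      by (intro tendsto_intros)
    moreover have "\<forall>\<^sub>F k in sequentially.
        y (t k + 1) * (u (t k) * (i - e) + y (t k + 1) + v (t k) * (i - e))
        \<le> y (t k + 1) * (u (t k) * y (t k + 2) + y (t k + 1) + v (t k) * y (t k))"
      using shift[OF lower[OF that] t(1)]
      by eventually_elim (auto intro!: mult_left_mono add_mono nonneg)
    ultimately have "s * (1 * (i - e) + s + 1 * (i - e)) \<le> q"
      by (intro tendsto_le[OF _ filterlim_compose[OF lim t(1)]]) auto
    then show ?thesis by (simp add: algebra_simps)
  qed
  then have q2: "s * (2 * i + s) \<le> q"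
    by (intro tendsto_upperbound[where F = "at_right 0" and f = "\<lambda>e. s * (2 * (i - e) + s)"])
      (auto intro!: tendsto_eq_intros eventually_at_right_less[THEN eventually_mono])
  have "s\<^sup>2 \<le> i\<^sup>2"
    using q1 q2 by (simp add: algebra_simps power2_eq_square)
  then have "s = i"
    using is_nonneg Yle i s by (simp add: power2_le_iff_abs_le)
  then have "q / 3 = i\<^sup>2"
    using q1 q2 by (simp add: algebra_simps power2_eq_square)
  moreover have "Y \<longlonglongrightarrow> ereal i"
    using i s \<open>s = i\<close> by (intro Liminf_eq_Limsup) auto
  ultimately show ?thesis
    using is_nonneg by (simp add: Y_def)
qed

lemma tendsto_zero_two_step_contraction:
  fixes d e :: "nat \<Rightarrow> real"
  assumes nonneg: "\<And>n. 0 \<le> d n" and q: "q < 1"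
    and e: "e \<longlonglongrightarrow> 0"
    and step: "\<forall>\<^sub>F n in sequentially. d (n + 2) \<le> e n + q * d n"
  shows "d \<longlonglongrightarrow> 0"
proof -
  \<comment> \<open>The square root is the rate per single step; the maximum keeps it positive even
    if q is not.\<close>
  define r where "r = sqrt (max q (1/2))"
  have r: "0 < r" "r < 1" "q \<le> r\<^sup>2" using q by (auto simp: r_def)
  have "\<forall>\<^sub>F n in sequentially. d n < a" if "a > 0" for a
  proof -
    define b where "b = a / 2"
    have b: "0 < b" using that by (simp add: b_def)
    \<comment> \<open>Once e is below this threshold, the excess of d over b contracts by r^2 every
      two steps.\<close>
    have "0 < (1 - r\<^sup>2) * b" using b r by (simp add: abs_square_less_1)
    then have "\<forall>\<^sub>F n in sequentially. e n < (1 - r\<^sup>2) * b"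
      using order_tendstoD(2)[OF e] by blast
    with step have "\<forall>\<^sub>F n in sequentially. d (n + 2) - b \<le> r\<^sup>2 * (d n - b)"
    proof eventually_elim
      case (elim n)
      then show ?case
        using mult_right_mono[OF r(3) nonneg[of n]] by (simp add: algebra_simps)
    qed
    then obtain N where N: "\<And>n. n \<ge> N \<Longrightarrow> d (n + 2) - b \<le> r\<^sup>2 * (d n - b)"
      by (auto simp: eventually_sequentially)
    \<comment> \<open>Large enough for both starting values, so one geometric bound covers even and
      odd offsets.\<close>
    define M where "M = (d N + d (Suc N)) / r"
    have "0 \<le> M" using nonneg r by (simp add: M_def)
    have bound: "d (N + k) - b \<le> M * r ^ k" for k
    proof (induction k rule: induct_nat_012)
      case 0
      have "d N * r \<le> d N * 1" using nonneg r by (intro mult_left_mono) auto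
      also have "\<dots> \<le> d N + d (Suc N) + b * r" using nonneg r b by simp
      finally show ?case using r by (simp add: M_def field_simps)
    next
      case 1
      then show ?case using nonneg[of N] r b by (simp add: M_def)
    next
      case (ge2 k)
      have "d (N + Suc (Suc k)) - b \<le> r\<^sup>2 * (d (N + k) - b)"
        using N[of "N + k"] by simp
      also have "\<dots> \<le> r\<^sup>2 * (M * r ^ k)"
        using ge2 by (intro mult_left_mono) auto
      finally show ?case by (simp add: power2_eq_square mult_ac)
    qed
    have "(\<lambda>k. M * r ^ k) \<longlonglongrightarrow> M * 0"
      using r by (intro tendsto_mult tendsto_const LIMSEQ_realpow_zero) auto
    then have "\<forall>\<^sub>F k in sequentially. M * r ^ k < b"
      using b by (intro order_tendstoD(2)) auto
    then have "\<forall>\<^sub>F k in sequentially. d (k + N) < a"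
      using bound by (auto elim!: eventually_mono simp: b_def add.commute intro: le_less_trans)
        (smt (verit) field_sum_of_halves)
    then show ?thesis
      using eventually_sequentially_seg[of "\<lambda>n. d n < a" N] by simp
  qed
  then show ?thesis
    by (intro order_tendstoI) (auto intro: always_eventually less_le_trans[OF _ nonneg])
qed

text \<open>The deviation from the fixed point z is multiplied by b / (z x), up to vanishing errors;
  the lower bound on x makes this factor eventually smaller than a constant below 1.\<close>

lemma riccati_recurrence_limit:
  fixes x A B l :: "nat \<Rightarrow> real"
  assumes rec: "\<And>n. x (n + 2) = A n - B n / x n"
    and A: "A \<longlonglongrightarrow> a" and B: "B \<longlonglongrightarrow> b" and "0 \<le> b"
    and lb: "\<And>n. l n \<le> x n" and l: "l \<longlonglongrightarrow> m" and "0 < m"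
    and z: "0 < z" "z = a - b / z" "b < z * m"
  shows "x \<longlonglongrightarrow> z"
proof -
  \<comment> \<open>Since l tends to m, x eventually exceeds m', while b / (z m') is still below
    1.\<close>
  obtain m' where m': "b / z < m'" "m' < m"
    using z dense[of "b / z" m] by (auto simp: field_simps)
  then have m'0: "0 < m'" using \<open>0 \<le> b\<close> z(1) by (smt (verit) divide_nonneg_pos)
  define e where "e n = \<bar>A n - a\<bar> + \<bar>B n - b\<bar> / m'" for n
  have "(\<lambda>n. \<bar>x n - z\<bar>) \<longlonglongrightarrow> 0"
  proof (rule tendsto_zero_two_step_contraction[where q = "b / (z * m')" and e = e])
    show "b / (z * m') < 1" using m' m'0 z(1) by (simp add: field_simps)
    have "e \<longlonglongrightarrow> \<bar>a - a\<bar> + \<bar>b - b\<bar> / m'"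
      unfolding e_def using m'0 by (intro tendsto_intros A B) auto
    then show "e \<longlonglongrightarrow> 0" by simp
    have "\<forall>\<^sub>F n in sequentially. m' < l n" using order_tendstoD(1)[OF l m'(2)] .
    then show "\<forall>\<^sub>F n in sequentially. \<bar>x (n + 2) - z\<bar> \<le> e n + b / (z * m') * \<bar>x n - z\<bar>"
    proof eventually_elim
      case (elim n)
      then have x: "m' < x n" "0 < x n" using lb[of n] m'0 by auto
      have "x (n + 2) - z = (A n - B n / x n) - (a - b / z)"
        using rec z(2) by simp
      also have "\<dots> = (A n - a) - (B n - b) / x n + b / (z * x n) * (x n - z)"
        using x z(1) by (simp add: field_simps)
      also have "\<bar>\<dots>\<bar> \<le> \<bar>A n - a\<bar> + \<bar>(B n - b) / x n\<bar> + \<bar>b / (z * x n) * (x n - z)\<bar>"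
        by (rule order.trans[OF abs_triangle_ineq]) (intro add_right_mono abs_triangle_ineq4)
      also have "\<bar>(B n - b) / x n\<bar> \<le> \<bar>B n - b\<bar> / m'"
        using x m'0 by (auto simp: abs_divide intro!: divide_left_mono)
      also have "\<bar>b / (z * x n) * (x n - z)\<bar> \<le> b / (z * m') * \<bar>x n - z\<bar>"
        using x m'0 z(1) \<open>0 \<le> b\<close>
        by (auto simp: abs_mult intro!: mult_right_mono divide_left_mono mult_left_mono)
      finally show ?case by (simp add: e_def)
    qed
  qed auto
  then show ?thesis
    by (simp add: tendsto_rabs_zero_iff LIM_zero_iff)
qed

section \<open>Asymptotics\<close>

context freud_polys
begin

text \<open>Dropping the positive neighbours in the string equation leaves 4 c^2 <= n.\<close>

lemma c_le: "c n \<le> sqrt (real n) / 2" if "n \<ge> 3"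
proof -
  define m where "m = n - 3"
  have m: "n = m + 3" using that by (simp add: m_def)
  have "(2 * c n)\<^sup>2 \<le> 4 * c n * (c (m + 4) + c n + c (m + 2))"
    using c_pos[of n] c_pos[of "m + 4"] c_pos[of "m + 2"]
    by (simp add: power2_eq_square algebra_simps)
  then have "(2 * c n)\<^sup>2 \<le> real n"
    using string_equation[of m] unfolding m by linarith
  then have "2 * c n \<le> sqrt (real n)"
    by (rule real_le_rsqrt)
  then show ?thesis by simp
qed

lemma c_asymp: "(\<lambda>n. c n / sqrt (real n)) \<longlonglongrightarrow> 1 / sqrt 12"
proof -
  let ?y = "\<lambda>n. c (n + 3) / sqrt (real (n + 3))"
  let ?u = "\<lambda>n. sqrt (real (n + 5)) / sqrt (real (n + 4))"
  let ?v = "\<lambda>n. sqrt (real (n + 3)) / sqrt (real (n + 4))"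
  have "?y \<longlonglongrightarrow> sqrt ((1 / 4) / 3)"
  proof (rule freud_limit[where u = ?u and v = ?v])
    show "?y n \<le> 1 / 2" for n
      using c_le[of "n + 3"] by (simp add: divide_simps)
    show "?u \<longlonglongrightarrow> 1" "?v \<longlonglongrightarrow> 1" by real_asymp+
    \<comment> \<open>The weights replace the neighbours' square roots by sqrt (n + 4), so this is
      exactly the string equation divided by 4 (n + 4).\<close>
    have eq: "?y (n + 1) * (?u n * ?y (n + 2) + ?y (n + 1) + ?v n * ?y n) = 1 / 4" for n
    proof -
      define s where "s = sqrt (real (n + 4))"
      have s: "s > 0" "s * s = real (n + 4)" by (simp_all add: s_def)
      have "?y (n + 1) * (?u n * ?y (n + 2) + ?y (n + 1) + ?v n * ?y n)
          = c (n + 4) / s * (c (n + 5) / s + c (n + 4) / s + c (n + 3) / s)"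
        by (simp add: s_def eval_nat_numeral)
      also have "\<dots> = c (n + 4) * (c (n + 5) + c (n + 4) + c (n + 3)) / (s * s)"
        by (simp add: add_divide_distrib[symmetric])
      also have "\<dots> = 1 / 4"
        using string_equation[of "n + 1"] s by (simp add: eval_nat_numeral field_simps)
      finally show ?thesis .
    qed
    show "(\<lambda>n. ?y (n + 1) * (?u n * ?y (n + 2) + ?y (n + 1) + ?v n * ?y n)) \<longlonglongrightarrow> 1 / 4"
      unfolding eq by (rule tendsto_const)
  qed (auto simp: less_imp_le[OF c_pos])
  then have "?y \<longlonglongrightarrow> 1 / sqrt 12"
    by (simp add: real_sqrt_divide)
  then show ?thesis by (rule LIMSEQ_offset)
qed

lemma c_asymp_shift:
  assumes "j \<le> k"
  shows "(\<lambda>n. c (n + j) / sqrt (real (n + k))) \<longlonglongrightarrow> 1 / sqrt 12"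
proof -
  have "(\<lambda>n. sqrt (real (n + j)) / sqrt (real (n + k))) \<longlonglongrightarrow> 1" by real_asymp
  from tendsto_mult[OF LIMSEQ_ignore_initial_segment[OF c_asymp, of j] this]
  have "(\<lambda>n. c (n + j) / sqrt (real (n + j)) * (sqrt (real (n + j)) / sqrt (real (n + k)))) \<longlonglongrightarrow> 1 / sqrt 12"
    by simp
  moreover have "\<forall>\<^sub>F n in sequentially.
      c (n + j) / sqrt (real (n + j)) * (sqrt (real (n + j)) / sqrt (real (n + k))) = c (n + j) / sqrt (real (n + k))"
    using eventually_gt_at_top[of 0] by eventually_elim simp
  ultimately show ?thesis
    by (rule Lim_transform_eventually)
qed

end

section \<open>Norm ratios along the decreasing parameter sequence\<close>

lemma powr_three_halves: "real n powr (3 / 2) = sqrt (real n) ^ 3"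
proof (cases "n = 0")
  case False
  then have "sqrt (real n) ^ 3 = (real n powr (1 / 2)) powr 3"
    by (simp add: powr_half_sqrt)
  then show ?thesis by (simp add: powr_powr)
qed simp

locale decreasing_sobolev = freud_polys +
  fixes lam :: "nat \<Rightarrow> real"
  assumes lam_pos: "\<And>n. 0 < lam n"
    and lam_dec: "decseq lam"
    and lam_ratio: "(\<lambda>n. lam (n - 2) / lam n) \<longlonglongrightarrow> 1"
begin

definition ratio :: "nat \<Rightarrow> real" where
  "ratio n = K (lam n) n / h n"

definition M :: "nat \<Rightarrow> real" where
  "M n = lam n * sqrt (real n) ^ 3"

text \<open>For n >= 3 this is the squared Sobolev norm of \<open>P n\<close> with parameter
  \<open>lam n\<close>, divided by \<open>h n\<close>.\<close>

definition A :: "nat \<Rightarrow> real" where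
  "A n = 1 + lam n * ((real n)\<^sup>2 / c n + 16 * c n * c (n - 1) * c (n - 2))"

lemma M_nonneg: "0 \<le> M n"
  using lam_pos[of n] by (simp add: M_def)

lemma ratio_ge_1: "1 \<le> ratio n"
  using K_ge_h[of "lam n" n] lam_pos[of n] h_pos[of n] by (simp add: ratio_def)

lemma ratio_ge: "1 + lam (Suc n) * (real (Suc n))\<^sup>2 / c (Suc n) \<le> ratio (Suc n)"
proof -
  have "(h (Suc n) + lam (Suc n) * (real (Suc n))\<^sup>2 * h n) / h (Suc n) \<le> ratio (Suc n)"
    unfolding ratio_def by (intro divide_right_mono K_ge less_imp_le[OF lam_pos] less_imp_le[OF h_pos])
  then show ?thesis
    by (simp add: c_def add_divide_distrib del: of_nat_Suc)
qed

lemma lead_term: "lam n * (real n)\<^sup>2 / c n = M n / (c n / sqrt (real n))"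
proof -
  have "(real n)\<^sup>2 = sqrt (real n) ^ 3 * sqrt (real n)"
    by (metis power3_eq_cube power2_eq_square real_sqrt_mult_self abs_of_nat mult.assoc)
  then show ?thesis by (simp add: M_def)
qed

lemma K_step:
  "K l (n + 3) / h (n + 3) = 1 + l * ((real (n + 3))\<^sup>2 / c (n + 3) + 16 * c (n + 3) * c (n + 2) * c (n + 1))
    - 16 * l\<^sup>2 * (real (n + 1))\<^sup>2 * c (n + 3) * c (n + 2) / (K l (n + 1) / h (n + 1))"
  if "0 \<le> l"
proof -
  have h: "h (n + 3) = c (n + 3) * h (n + 2)" "h (n + 2) = c (n + 2) * h (n + 1)" "h (n + 1) = c (n + 1) * h n"
    using h_Suc[of n] h_Suc[of "n + 1"] h_Suc[of "n + 2"] by (simp_all add: eval_nat_numeral)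
  \<comment> \<open>All norms are expressed through \<open>h n\<close>, which then cancels in an
    identity between free real variables.\<close>
  have algebra: "(c3 * (c2 * (c1 * h0)) + l * (N\<^sup>2 * (c2 * (c1 * h0)) + 16 * (c3 * (c2 * (c1 * h0)))\<^sup>2 / h0)
      - 16 * l\<^sup>2 * m\<^sup>2 * (c3 * (c2 * (c1 * h0)))\<^sup>2 / k) / (c3 * (c2 * (c1 * h0)))
    = 1 + l * (N\<^sup>2 / c3 + 16 * c3 * c2 * c1) - 16 * l\<^sup>2 * m\<^sup>2 * c3 * c2 / (k / (c1 * h0))"
    if "c1 \<noteq> 0" "c2 \<noteq> 0" "c3 \<noteq> 0" "h0 \<noteq> 0" for c1 c2 c3 h0 k N m :: real
    using that by (simp add: diff_divide_distrib add_divide_distrib distrib_left power2_eq_square)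
  show ?thesis
    unfolding K_recurrence[OF that] h
    by (rule algebra) simp_all
qed

lemma ratio_le: "ratio (n + 3) \<le> A (n + 3)"
proof -
  have "0 \<le> 16 * (lam (n + 3))\<^sup>2 * (real (n + 1))\<^sup>2 * c (n + 3) * c (n + 2) / (K (lam (n + 3)) (n + 1) / h (n + 1))"
    using K_pos[of "lam (n + 3)" "n + 1"] lam_pos[of "n + 3"] h_pos[of "n + 1"] c_pos[of "n + 2"] c_pos[of "n + 3"]
    by simp
  then show ?thesis
    unfolding ratio_def A_def K_step[OF less_imp_le[OF lam_pos]] by (simp add: eval_nat_numeral)
qed

lemma A_limit:
  assumes "M \<longlonglongrightarrow> r"
  shows "(\<lambda>n. A (n + 3)) \<longlonglongrightarrow> 1 + r * 20 / (3 * sqrt 3)"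
proof -
  have s: "sqrt 12 = 2 * sqrt 3" using real_sqrt_mult[of 4 3] by simp
  have "(\<lambda>n. 1 + (M (n + 3) / (c (n + 3) / sqrt (real (n + 3))) + 16 * (M (n + 3) *
      (c (n + 3) / sqrt (real (n + 3))) * (c (n + 2) / sqrt (real (n + 3))) * (c (n + 1) / sqrt (real (n + 3))))))
    \<longlonglongrightarrow> 1 + (r / (1 / sqrt 12) + 16 * (r * (1 / sqrt 12) * (1 / sqrt 12) * (1 / sqrt 12)))"
    by (intro tendsto_intros c_asymp_shift LIMSEQ_ignore_initial_segment[OF assms]) auto
  \<comment> \<open>The constant is 2 sqrt 3 + 2 / (3 sqrt 3).\<close>
  also have "1 + (r / (1 / sqrt 12) + 16 * (r * (1 / sqrt 12) * (1 / sqrt 12) * (1 / sqrt 12))) = 1 + r * 20 / (3 * sqrt 3)"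
    by (simp add: s field_simps)
  also have "(\<lambda>n. 1 + (M (n + 3) / (c (n + 3) / sqrt (real (n + 3))) + 16 * (M (n + 3) *
      (c (n + 3) / sqrt (real (n + 3))) * (c (n + 2) / sqrt (real (n + 3))) * (c (n + 1) / sqrt (real (n + 3))))))
    = (\<lambda>n. A (n + 3))"
    unfolding A_def distrib_left lead_term[symmetric]
    by (rule ext) (simp add: M_def power3_eq_cube eval_nat_numeral)
  finally show ?thesis .
qed

text \<open>The recurrence relates \<open>K\<close> at two degrees for the same parameter; monotonicity of \<open>K l n\<close> and
  \<open>K l n / l\<close> in \<open>l\<close> bounds the error made by replacing \<open>lam (n + 3)\<close> with \<open>lam (n + 1)\<close>.\<close>

lemma K_change_parameter:
  "(\<lambda>n. K (lam (n + 3)) (n + 1) / K (lam (n + 1)) (n + 1)) \<longlonglongrightarrow> 1"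
proof (rule tendsto_sandwich)
  have "(\<lambda>n. lam (n + 1) / lam (n + 3)) \<longlonglongrightarrow> 1"
    using LIMSEQ_ignore_initial_segment[OF lam_ratio, of 3] by (simp add: eval_nat_numeral)
  from tendsto_inverse[OF this] show "(\<lambda>n. lam (n + 3) / lam (n + 1)) \<longlonglongrightarrow> 1"
    by simp
  have dec: "lam (n + 3) \<le> lam (n + 1)" for n
    using lam_dec by (rule decseqD) simp
  have K: "0 < K (lam m) n" for m n
    using lam_pos[of m] by (intro K_pos) simp
  show "\<forall>\<^sub>F n in sequentially. lam (n + 3) / lam (n + 1) \<le> K (lam (n + 3)) (n + 1) / K (lam (n + 1)) (n + 1)"
  proof (intro always_eventually allI)
    fix n
    show "lam (n + 3) / lam (n + 1) \<le> K (lam (n + 3)) (n + 1) / K (lam (n + 1)) (n + 1)"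
      using K_scale[OF lam_pos dec, of n "n + 1"] K[of "n + 1" "n + 1"] lam_pos[of "n + 1"] lam_pos[of "n + 3"]
      by (simp add: field_simps)
  qed
  show "\<forall>\<^sub>F n in sequentially. K (lam (n + 3)) (n + 1) / K (lam (n + 1)) (n + 1) \<le> 1"
    using K_mono[OF less_imp_le[OF lam_pos] dec] K by (intro always_eventually allI) simp
qed simp

text \<open>With a = 2 t w and b = t^2, the fixed-point equation z^2 = a z - b has larger root t
  \<open>phi w\<close>, to which the Riccati lemma applies.\<close>

lemma ratio_limit_finite:
  assumes M: "M \<longlonglongrightarrow> r" and r: "0 < r"
  shows "ratio \<longlonglongrightarrow> 2 * r / sqrt 3 * phi ((20 * r + 3 * sqrt 3) / (12 * r))"
proof -
  define a where "a = 1 + r * 20 / (3 * sqrt 3)"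
  define b where "b = 4 / 3 * r\<^sup>2"
  define w where "w = (20 * r + 3 * sqrt 3) / (12 * r)"
  define t where "t = 2 * r / sqrt 3"
  \<comment> \<open>The quotient of \<open>K\<close> values trades the parameter
    \<open>lam (n + 3)\<close> of the recurrence for the \<open>lam (n + 1)\<close> in
    \<open>ratio (n + 1)\<close>; it tends to 1.\<close>
  define B where "B n = 16 * (lam (n + 3))\<^sup>2 * (real (n + 1))\<^sup>2 * c (n + 3) * c (n + 2)
    / (K (lam (n + 3)) (n + 1) / K (lam (n + 1)) (n + 1))" for n
  have "(\<lambda>n. ratio (n + 1)) \<longlonglongrightarrow> t * phi w"
  proof (rule riccati_recurrence_limit[where A = "\<lambda>n. A (n + 3)" and B = B and a = a and b = b
        and l = "\<lambda>n. 1 + M (n + 1) / (c (n + 1) / sqrt (real (n + 1)))" and m = "1 + r / (1 / sqrt 12)"])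
    show "ratio (n + 2 + 1) = A (n + 3) - B n / ratio (n + 1)" for n
      using K_step[of "lam (n + 3)" n] lam_pos[of "n + 3"] K_pos[of "lam (n + 1)" "n + 1"] lam_pos[of "n + 1"]
      by (simp add: ratio_def A_def B_def eval_nat_numeral)
    show "(\<lambda>n. A (n + 3)) \<longlonglongrightarrow> a"
      unfolding a_def by (rule A_limit[OF M])
    have n: "(\<lambda>n. real (n + 1) / real (n + 3)) \<longlonglongrightarrow> 1" by real_asymp
    have "(\<lambda>n. 16 * (M (n + 3))\<^sup>2 * (real (n + 1) / real (n + 3))\<^sup>2 *
        (c (n + 3) / sqrt (real (n + 3))) * (c (n + 2) / sqrt (real (n + 3)))
        / (K (lam (n + 3)) (n + 1) / K (lam (n + 1)) (n + 1)))
      \<longlonglongrightarrow> 16 * r\<^sup>2 * 1\<^sup>2 * (1 / sqrt 12) * (1 / sqrt 12) / 1"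
      by (intro tendsto_intros n c_asymp_shift LIMSEQ_ignore_initial_segment[OF M] K_change_parameter) auto
    also have "16 * r\<^sup>2 * 1\<^sup>2 * (1 / sqrt 12) * (1 / sqrt 12) / 1 = b"
      by (simp add: b_def)
    also have "(\<lambda>n. 16 * (M (n + 3))\<^sup>2 * (real (n + 1) / real (n + 3))\<^sup>2 *
        (c (n + 3) / sqrt (real (n + 3))) * (c (n + 2) / sqrt (real (n + 3)))
        / (K (lam (n + 3)) (n + 1) / K (lam (n + 1)) (n + 1))) = B"
    proof
      fix n
      define s where "s = sqrt (real (n + 3))"
      have s: "s > 0" "real (n + 3) = s * s" by (simp_all add: s_def)
      show "16 * (M (n + 3))\<^sup>2 * (real (n + 1) / real (n + 3))\<^sup>2 *
        (c (n + 3) / sqrt (real (n + 3))) * (c (n + 2) / sqrt (real (n + 3)))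
        / (K (lam (n + 3)) (n + 1) / K (lam (n + 1)) (n + 1)) = B n"
        unfolding B_def M_def s_def[symmetric] unfolding s(2)
        by (intro arg_cong2[where f = "(/)"] refl) (use s(1) in \<open>simp add: power2_eq_square power3_eq_cube\<close>)
    qed
    finally show "B \<longlonglongrightarrow> b" .
    show "1 + M (n + 1) / (c (n + 1) / sqrt (real (n + 1))) \<le> ratio (n + 1)" for n
      using ratio_ge[of n] lead_term[of "Suc n"] by simp
    show "(\<lambda>n. 1 + M (n + 1) / (c (n + 1) / sqrt (real (n + 1)))) \<longlonglongrightarrow> 1 + r / (1 / sqrt 12)"
      by (intro tendsto_intros c_asymp_shift LIMSEQ_ignore_initial_segment[OF M]) auto
    have w: "w > 1" using r by (simp add: w_def field_simps add_pos_nonneg)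
    have t: "t > 0" "b = t\<^sup>2" using r by (auto simp: t_def b_def power_divide power_mult_distrib)
    have a: "a = 2 * t * w" using r by (simp add: a_def t_def w_def field_simps)
    have "sqrt (w\<^sup>2 - 1) \<ge> 0" using w by simp
    then have ge: "w \<le> phi w" by (simp add: phi_def)
    with w t show pos: "0 < t * phi w" by simp
    have "(sqrt (w\<^sup>2 - 1))\<^sup>2 = w\<^sup>2 - 1" using w by simp
    then have "(phi w)\<^sup>2 = 2 * w * phi w - 1"
      by (simp add: phi_def power2_eq_square algebra_simps)
    then have "t\<^sup>2 * (phi w)\<^sup>2 = t\<^sup>2 * (2 * w * phi w - 1)"
      by simp
    then have "(t * phi w) * (t * phi w) = a * (t * phi w) - b"
      by (simp add: a t power2_eq_square algebra_simps)
    moreover have "z = a - b / z" if "z * z = a * z - b" "0 < z" for z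
      using that by (simp add: field_simps)
    ultimately show "t * phi w = a - b / (t * phi w)"
      using pos by blast
    \<comment> \<open>The right side is 20/3 r^2. Since t \<open>phi w\<close> >= t w = a / 2, even
      this crude bound places the limiting lower bound above b / z.\<close>
    have "4 / 3 * r\<^sup>2 < r * 10 / (3 * sqrt 3) * (r * sqrt 12)"
      using r real_sqrt_mult[of 4 3] by (simp add: power2_eq_square)
    also have "\<dots> \<le> a / 2 * (1 + r / (1 / sqrt 12))"
      using r by (intro mult_mono) (auto simp: a_def)
    also have "\<dots> \<le> t * phi w * (1 + r / (1 / sqrt 12))"
      using r t ge by (intro mult_right_mono) (auto simp: a)
    finally show "b < t * phi w * (1 + r / (1 / sqrt 12))" by (simp add: b_def)
  qed (use r in \<open>auto simp: b_def add_pos_pos\<close>)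
  then have "ratio \<longlonglongrightarrow> t * phi w" by (rule LIMSEQ_offset)
  then show ?thesis by (simp add: t_def w_def)
qed

text \<open>Squeeze between 1 and \<open>A\<close>, whose limit is then 1; no Riccati argument is
  needed.\<close>

lemma ratio_limit_zero:
  assumes "M \<longlonglongrightarrow> 0"
  shows "ratio \<longlonglongrightarrow> 1"
proof -
  have "(\<lambda>n. ratio (n + 3)) \<longlonglongrightarrow> 1"
  proof (rule tendsto_sandwich[where f = "\<lambda>_. 1" and h = "\<lambda>n. A (n + 3)"])
    show "(\<lambda>n. A (n + 3)) \<longlonglongrightarrow> 1" using A_limit[OF assms] by simp
  qed (auto simp: ratio_ge_1 ratio_le)
  then show ?thesis by (rule LIMSEQ_offset)
qed

text \<open>The lower bound from the derivative term is M n divided by a number at most 1; this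
  forces divergence when L is infinite.\<close>

lemma M_le_ratio:
  assumes "3 \<le> n"
  shows "M n \<le> ratio n"
proof -
  obtain k where k: "n = Suc k" using assms by (cases n) auto
  have "c n \<le> sqrt (real n)"
    using c_le[OF assms] c_pos[of n] by linarith
  then have "c n / sqrt (real n) \<le> 1"
    using assms by simp
  then have "M n \<le> M n / (c n / sqrt (real n))"
    using divide_left_mono[of "c n / sqrt (real n)" 1 "M n"] M_nonneg[of n] c_pos[of n] assms by simp
  then show ?thesis
    using ratio_ge[of k] lead_term[of n] by (simp add: k)
qed

end

theorem proposition1:
  fixes lam :: "nat \<Rightarrow> real" and L :: ereal and P S :: "nat \<Rightarrow> real poly"
  assumes "\<And>n. lam n > 0"
    and "decseq lam"
    and "(\<lambda>n. lam (n - 2) / lam n) \<longlonglongrightarrow> 1"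
    and "0 \<le> L"
    and "(\<lambda>n. ereal (real n powr (3 / 2) * lam n)) \<longlonglongrightarrow> L"
    and "\<And>n. monic_orthogonal n (P n)"
    and "\<And>n. sobolev_minimizer n (lam n) (S n)"
  shows "(\<lambda>n. ereal (sobolev_inner (lam n) (S n) (S n) / freud_inner (P n) (P n)))
           \<longlonglongrightarrow> (if L = 0 then 1
             else if L = \<infinity> then \<infinity>
             else ereal (2 * real_of_ereal L / sqrt 3 *
               phi ((20 * real_of_ereal L + 3 * sqrt 3) / (12 * real_of_ereal L))))"
proof -
  interpret decreasing_sobolev P lam
    using assms by unfold_locales auto
  \<comment> \<open>Only the minimal value enters, so the given minimizer may be replaced by
    \<open>sob (lam n) n\<close>.\<close>
  have ratio: "sobolev_inner (lam n) (S n) (S n) / freud_inner (P n) (P n) = ratio n" for n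
    using sobolev_minimizer_norm[OF less_imp_le[OF assms(1)] assms(7)] by (simp add: ratio_def h_def)
  have M: "(\<lambda>n. ereal (M n)) \<longlonglongrightarrow> L"
    using assms(5) by (simp add: M_def powr_three_halves mult.commute)
  show ?thesis
  proof (cases L)
    case (real r)
    then have r: "M \<longlonglongrightarrow> r" "0 \<le> r" using M assms(4) by auto
    show ?thesis
    proof (cases "r = 0")
      case True
      then show ?thesis
        using ratio_limit_zero r real by (simp add: ratio one_ereal_def zero_ereal_def)
    next
      case False
      then show ?thesis
        using ratio_limit_finite[of r] r real by (simp add: ratio zero_ereal_def)
    qed
  next
    case PInf
    have "\<forall>\<^sub>F n in sequentially. M n \<le> ratio n"
      using eventually_ge_at_top[of 3] by eventually_elim (rule M_le_ratio)
    moreover have "filterlim M at_top sequentially"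
      using M PInf by (simp add: tendsto_PInfty_eq_at_top)
    ultimately have "filterlim ratio at_top sequentially"
      by (rule filterlim_at_top_mono[rotated])
    then show ?thesis
      using PInf by (simp add: ratio tendsto_PInfty_eq_at_top)
  next
    case MInf
    with assms(4) show ?thesis by simp
  qed
qed

end
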